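(* Let $p\le n$, let $f:\mathbb R^{n\times p}\to\mathbb R$ be continuously differentiable, $c(X)=\frac12(X^\top X-\mathrm I_p)$ and $\psi(X)=\frac12\|c(X)\|^2$. For $X\in\mathbb R^{n\times p}$ of full rank $p$, consider the metric $$g(\xi,\zeta)=\langle\xi,(XX^\top+\mathrm I_n-X(X^\top X)^{-1}X^\top)\zeta\rangle .$$ Then the landing directions $d_T(X)=-\mathrm{grad}^g_{\mathrm{St}_{X^\top X}}f(X)$ and $d_N(X)=-\nabla_g\psi(X)$ are $$d_T(X)=-X(X^\top X)^{-1}\operatorname{skew}\big((X^\top X)^{-1}X^\top\nabla_{\mathcal E}f(X)\big)-(\mathrm I_n-X(X^\top X)^{-1}X^\top)\nabla_{\mathcal E}f(X),$$ $$d_N(X)=-\tfrac12X\big(\mathrm I_p-(X^\top X)^{-1}\big).$$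
   Context: $\langle X,Y\rangle=\operatorname{trace}(X^\top Y)$ and $\|\cdot\|$ are the Frobenius inner product and norm; $\nabla_{\mathcal E}f$ is the gradient for the Frobenius inner product; $\operatorname{skew}(A)=(A-A^\top)/2$. $\mathrm{St}_{X^\top X}=\{Y\in\mathbb R^{n\times p}:Y^\top Y=X^\top X\}$, with tangent space at $X$ equal to $\mathrm T_X\mathrm{St}_{X^\top X}=\{\xi\in\mathbb R^{n\times p}:\xi^\top X+X^\top\xi=0\}$. $\mathrm{grad}^g_{\mathrm{St}_{X^\top X}}f(X)$ is the unique vector of this tangent space with $g(\mathrm{grad}^g f(X),\xi)=\mathrm Df(X)[\xi]$ for all tangent $\xi$; $\nabla_g\psi(X)$ is the unique matrix in $\mathbb R^{n\times p}$ with $g(\nabla_g\psi(X),\xi)=\mathrm D\psi(X)[\xi]$ for all $\xi\in\mathbb R^{n\times p}$. *)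

theory Defs
  imports "HOL-Analysis.Analysis"
begin

text \<open>
  Real \<open>n \<times> p\<close> matrices are elements of \<^typ>\<open>real^'p^'n\<close>. The inner product and norm that the
  library puts on this type are the Frobenius ones.
\<close>

lemma inner_matrix_eq_trace:
  fixes X Y :: "real^'p^'n"
  shows "X \<bullet> Y = trace (transpose X ** Y)"
  unfolding inner_vec_def trace_def matrix_matrix_mult_def transpose_def
  by (simp add: sum.swap[of _ "UNIV :: 'n set"])

definition skew :: "real^'p^'p \<Rightarrow> real^'p^'p" where
  "skew A = (1/2) *\<^sub>R (A - transpose A)"

definition continuously_differentiable :: "('a::real_normed_vector \<Rightarrow> 'b::real_normed_vector) \<Rightarrow> bool" where
  "continuously_differentiable f \<longleftrightarrow>
    (\<exists>f' :: 'a \<Rightarrow> 'a \<Rightarrow>\<^sub>L 'b. (\<forall>x. (f has_derivative blinfun_apply (f' x)) (at x)) \<and> continuous_on UNIV f')"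

text \<open>
  The gradient at \<open>X\<close> of \<open>f\<close> with respect to the bilinear form \<open>g\<close> on the subspace \<open>T\<close>: the
  representative in \<open>T\<close> of the derivative of \<open>f\<close> restricted to \<open>T\<close>. It is well defined when
  \<open>g\<close> is positive definite on \<open>T\<close>, see \<open>ex1_gradient_wrt\<close> and, for the
  gradients used here, \<open>ex1_landing_gradients\<close> below.
\<close>

definition gradient_wrt ::
  "('a \<Rightarrow> 'a \<Rightarrow> real) \<Rightarrow> 'a set \<Rightarrow> ('a::real_normed_vector \<Rightarrow> real) \<Rightarrow> 'a \<Rightarrow> 'a" where
  "gradient_wrt g T f X = (THE v. v \<in> T \<and> (\<forall>\<xi>\<in>T. g v \<xi> = frechet_derivative f (at X) \<xi>))"

abbreviation euclidean_gradient :: "('a::real_inner \<Rightarrow> real) \<Rightarrow> 'a \<Rightarrow> 'a" where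
  "euclidean_gradient \<equiv> gradient_wrt (\<bullet>) UNIV"

text \<open>The tangent space at \<open>X\<close> of \<open>{Y. transpose Y ** Y = transpose X ** X}\<close>.\<close>

definition stiefel_tangent :: "real^'p^'n \<Rightarrow> (real^'p^'n) set" where
  "stiefel_tangent X = {\<xi>. transpose \<xi> ** X + transpose X ** \<xi> = 0}"

definition orth_defect :: "real^'p^'n \<Rightarrow> real^'p^'p" where
  "orth_defect X = (1/2) *\<^sub>R (transpose X ** X - mat 1)"

definition orth_penalty :: "real^'p^'n \<Rightarrow> real" where
  "orth_penalty X = (1/2) * (norm (orth_defect X))\<^sup>2"

definition landing_metric :: "real^'p^'n \<Rightarrow> real^'p^'n \<Rightarrow> real^'p^'n \<Rightarrow> real" where
  "landing_metric X \<xi> \<zeta> =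
    \<xi> \<bullet> ((X ** transpose X + mat 1 - X ** matrix_inv (transpose X ** X) ** transpose X) ** \<zeta>)"

definition landing_tangent ::
  "(real^'p^'n \<Rightarrow> real^'p^'n \<Rightarrow> real^'p^'n \<Rightarrow> real) \<Rightarrow> (real^'p^'n \<Rightarrow> real) \<Rightarrow> real^'p^'n \<Rightarrow> real^'p^'n" where
  "landing_tangent g f X = - gradient_wrt (g X) (stiefel_tangent X) f X"

definition landing_normal ::
  "(real^'p^'n \<Rightarrow> real^'p^'n \<Rightarrow> real^'p^'n \<Rightarrow> real) \<Rightarrow> real^'p^'n \<Rightarrow> real^'p^'n" where
  "landing_normal g X = - gradient_wrt (g X) UNIV orth_penalty X"


subsection \<open>Well-definedness of the gradients\<close>

lemma ex1_gradient_wrt: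
  fixes f :: "'a::euclidean_space \<Rightarrow> real"
  assumes T: "subspace T"
    and lin1: "\<And>\<zeta>. linear (\<lambda>\<xi>. g \<xi> \<zeta>)" and lin2: "\<And>\<xi>. linear (g \<xi>)"
    and pos: "\<And>\<xi>. \<lbrakk>\<xi> \<in> T; \<xi> \<noteq> 0\<rbrakk> \<Longrightarrow> g \<xi> \<xi> > 0"
    and diff: "f differentiable at X"
  shows "\<exists>!v. v \<in> T \<and> (\<forall>\<xi>\<in>T. g v \<xi> = frechet_derivative f (at X) \<xi>)"
proof -
  define L where "L = frechet_derivative f (at X)"
  have linL: "linear L"
    unfolding L_def using diff by (rule linear_frechet_derivative)
  have zero: "u = 0" if "u \<in> T" "\<And>\<xi>. \<xi> \<in> T \<Longrightarrow> g u \<xi> = 0" for u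
    using that pos by fastforce
  obtain B where B: "B \<subseteq> T" "pairwise orthogonal B" "\<And>x. x \<in> B \<Longrightarrow> norm x = 1"
      "independent B" "span B = T"
    using orthonormal_basis_subspace[OF T] by metis
  have fin: "finite B"
    using B(4) independent_imp_finite by blast
  have coord: "(\<Sum>b\<in>B. a b *\<^sub>R b) \<bullet> c = a c" if "c \<in> B" for a :: "'a \<Rightarrow> real" and c
  proof -
    have "(\<Sum>b\<in>B. a b *\<^sub>R b) \<bullet> c = (\<Sum>b\<in>B. if b = c then a c else 0)"
      unfolding inner_sum_left
    proof (rule sum.cong[OF refl])
      fix b assume "b \<in> B"
      then show "a b *\<^sub>R b \<bullet> c = (if b = c then a c else 0)"
        using B(2) B(3)[OF that] that by (auto simp: pairwise_def orthogonal_def norm_eq_1)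
    qed
    then show ?thesis using that fin by simp
  qed
  have ext: "\<forall>\<xi>\<in>T. h \<xi> = k \<xi>" if "linear h" "linear k" "\<And>b. b \<in> B \<Longrightarrow> h b = k b" for h k :: "'a \<Rightarrow> real"
    using linear_eq_on_span[OF that] B(5) by blast
  define \<Phi> where "\<Phi> v = (\<Sum>b\<in>B. g v b *\<^sub>R b)" for v
  have lin\<Phi>: "linear \<Phi>"
    unfolding \<Phi>_def
    by (rule linearI)
      (simp_all add: linear_add[OF lin1] linear_scale[OF lin1] scaleR_left_distrib sum.distrib scaleR_sum_right)
  have inj: "inj_on \<Phi> T"
  proof (rule inj_onI)
    fix u v assume uv: "u \<in> T" "v \<in> T" "\<Phi> u = \<Phi> v"
    have "g (u - v) b = 0" if "b \<in> B" for b
      using coord[OF that, of "g u"] coord[OF that, of "g v"] uv(3)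
      by (simp add: \<Phi>_def linear_diff[OF lin1])
    then have "\<forall>\<xi>\<in>T. g (u - v) \<xi> = 0"
      using ext[OF lin2, of "\<lambda>_. 0"] module_hom_zero by blast
    then show "u = v"
      using zero[of "u - v"] uv T by (auto simp: subspace_diff)
  qed
  have mem: "(\<Sum>b\<in>B. a b *\<^sub>R b) \<in> T" for a :: "'a \<Rightarrow> real"
    using B(1) T by (intro subspace_sum subspace_scale) auto
  have "\<Phi> ` T = T"
  proof (rule subspace_dim_equal)
    show "subspace (\<Phi> ` T)" using lin\<Phi> T by (rule linear_subspace_image)
    show "\<Phi> ` T \<subseteq> T" using mem by (auto simp: \<Phi>_def)
    have "dim (\<Phi> ` T) = dim T"
      using inj by (intro dim_image_eq[OF lin\<Phi>]) (simp only: span_eq_iff[THEN iffD2, OF T])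
    then show "dim T \<le> dim (\<Phi> ` T)" by simp
  qed (rule T)
  then obtain v where v: "v \<in> T" "\<Phi> v = (\<Sum>b\<in>B. L b *\<^sub>R b)"
    using mem[of L] by (metis imageE)
  have "g v b = L b" if "b \<in> B" for b
    using coord[OF that, of "g v"] coord[OF that, of L] v(2) by (simp add: \<Phi>_def)
  then have "\<forall>\<xi>\<in>T. g v \<xi> = L \<xi>"
    by (rule ext[OF lin2 linL])
  moreover have "u = v" if "u \<in> T" "\<forall>\<xi>\<in>T. g u \<xi> = L \<xi>" for u
    using zero[of "u - v"] that v(1) calculation T by (auto simp: subspace_diff linear_diff[OF lin1])
  ultimately show ?thesis
    using v(1) unfolding L_def by blast
qed

lemma matrix_diff_rdistrib:
  fixes A B :: "real^'m^'n"
  shows "(A - B) ** C = A ** C - B ** C"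
  by (vector matrix_matrix_mult_def sum_subtractf[symmetric] field_simps)

lemma matrix_add_rdistrib:
  fixes A B :: "real^'m^'n"
  shows "(A + B) ** C = A ** C + B ** C"
  by (vector matrix_matrix_mult_def sum.distrib[symmetric] field_simps)

lemma matrix_diff_ldistrib:
  fixes B C :: "real^'p^'m"
  shows "A ** (B - C) = A ** B - A ** C"
  by (vector matrix_matrix_mult_def sum_subtractf[symmetric] field_simps)

lemma inner_matrix_mult_left:
  fixes A :: "real^'m^'n" and Y :: "real^'p^'m" and Z :: "real^'p^'n"
  shows "Z \<bullet> (A ** Y) = (transpose A ** Z) \<bullet> Y"
  by (simp add: inner_matrix_eq_trace matrix_transpose_mul matrix_mul_assoc)

lemma invertible_gram:
  fixes X :: "real^'p^'n"
  assumes "rank X = CARD('p)"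
  shows "invertible (transpose X ** X)"
proof -
  have "x = 0" if "(transpose X ** X) *v x = 0" for x
  proof -
    have "(X *v x) \<bullet> (X *v x) = 0"
      using that by (metis dot_lmul_matrix inner_zero_right matrix_vector_mul_assoc vector_transpose_matrix transpose_transpose)
    then have "X *v x = 0" by simp
    then show "x = 0"
      using assms full_rank_injective[of X] by (metis injD matrix_vector_mult_0_right)
  qed
  then show ?thesis
    using invertible_left_inverse matrix_left_invertible_ker by blast
qed

lemma landing_metric_inner_product:
  fixes X :: "real^'p^'n"
  assumes "rank X = CARD('p)"
  shows "linear (\<lambda>\<xi>. landing_metric X \<xi> \<zeta>)" "linear (landing_metric X \<xi>)"
    and "landing_metric X \<xi> \<zeta> = landing_metric X \<zeta> \<xi>"
    and "\<xi> \<noteq> 0 \<Longrightarrow> landing_metric X \<xi> \<xi> > 0"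
proof -
  define S where "S = transpose X ** X"
  define R where "R = matrix_inv S"
  define P where "P = X ** R ** transpose X"
  define G where "G = X ** transpose X + mat 1 - P"
  have metric: "landing_metric X \<xi> \<zeta> = \<xi> \<bullet> (G ** \<zeta>)" for \<xi> \<zeta>
    by (simp add: landing_metric_def G_def P_def R_def S_def)
  have "\<exists>A. S ** A = mat 1 \<and> A ** S = mat 1"
    using invertible_gram[OF assms] by (simp add: S_def invertible_def)
  then have RS: "S ** R = mat 1 \<and> R ** S = mat 1"
    unfolding R_def matrix_inv_def by (rule someI_ex)
  have "transpose S = S"
    by (simp add: S_def matrix_transpose_mul)
  then have "S ** transpose R = mat 1"
    using RS by (metis matrix_transpose_mul transpose_mat)
  then have RT: "transpose R = R"
    using RS by (metis matrix_mul_assoc matrix_mul_lid matrix_mul_rid)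
  have PT: "transpose P = P"
    by (simp add: P_def matrix_transpose_mul RT matrix_mul_assoc)
  have "P ** P = X ** R ** S ** R ** transpose X"
    by (simp add: P_def S_def matrix_mul_assoc)
  also have "\<dots> = P"
    using RS by (metis P_def matrix_mul_assoc matrix_mul_lid)
  finally have PP: "P ** P = P" .
  have GT: "transpose G = G"
  proof -
    have "transpose (A + B - C) = transpose A + transpose B - transpose C" for A B C :: "real^'n^'n"
      by (simp add: transpose_def vec_eq_iff)
    then show ?thesis
      by (simp add: G_def PT matrix_transpose_mul)
  qed
  show "linear (\<lambda>\<xi>. landing_metric X \<xi> \<zeta>)"
    unfolding metric by (rule linearI) (simp_all add: inner_left_distrib)
  show sym: "landing_metric X \<xi> \<zeta> = landing_metric X \<zeta> \<xi>" for \<xi> \<zeta>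
    unfolding metric by (metis inner_matrix_mult_left GT inner_commute)
  show "linear (landing_metric X \<xi>)"
    unfolding metric inner_matrix_mult_left by (rule linearI) (simp_all add: inner_right_distrib)
  show "landing_metric X \<xi> \<xi> > 0" if "\<xi> \<noteq> 0"
  proof -
    define u where "u = transpose X ** \<xi>"
    define w where "w = \<xi> - P ** \<xi>"
    have Gxi: "G ** \<xi> = X ** u + w"
      by (simp add: G_def u_def w_def matrix_diff_rdistrib matrix_add_rdistrib matrix_mul_assoc)
    have "P ** w = 0"
      by (simp add: w_def matrix_diff_ldistrib matrix_mul_assoc PP)
    then have "(P ** \<xi>) \<bullet> w = 0"
      using inner_matrix_mult_left[of \<xi> P w] by (simp add: PT)
    then have "\<xi> \<bullet> w = w \<bullet> w"
      by (simp add: w_def inner_diff_left)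
    moreover have "\<xi> \<bullet> (X ** u) = u \<bullet> u"
      unfolding inner_matrix_mult_left by (simp add: u_def)
    ultimately have eq: "landing_metric X \<xi> \<xi> = u \<bullet> u + w \<bullet> w"
      by (simp add: metric Gxi inner_right_distrib)
    have "u \<noteq> 0 \<or> w \<noteq> 0"
    proof (rule ccontr)
      assume "\<not> (u \<noteq> 0 \<or> w \<noteq> 0)"
      then have u: "u = 0" and w: "w = 0" by auto
      have "\<xi> = P ** \<xi>" using w by (simp add: w_def)
      also have "\<dots> = X ** R ** u" by (simp add: P_def u_def matrix_mul_assoc)
      also have "\<dots> = 0" unfolding u by (simp add: matrix_matrix_mult_def vec_eq_iff)
      finally show False using that by simp
    qed
    then show ?thesis
      unfolding eq by (metis add_nonneg_pos add_pos_nonneg inner_ge_zero inner_gt_zero_iff)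
  qed
qed

lemma subspace_stiefel_tangent: "subspace (stiefel_tangent X)"
proof -
  have "linear (\<lambda>\<xi>. transpose \<xi> ** X + transpose X ** \<xi>)"
    by (rule linearI)
      (simp_all add: vec_eq_iff matrix_matrix_mult_def transpose_def sum.distrib sum_distrib_left algebra_simps)
  then show ?thesis
    unfolding stiefel_tangent_def by (rule linear_subspace_kernel)
qed

lemma differentiable_orth_penalty:
  fixes X :: "real^'p^'n"
  shows "orth_penalty differentiable at X"
proof -
  have entry: "(\<lambda>Y :: real^'p^'n. Y $ k $ i) differentiable at X" for k i
    by (intro bounded_linear_imp_differentiable bounded_linear_compose[OF bounded_linear_vec_nth] bounded_linear_vec_nth)
  have eq: "orth_penalty = (\<lambda>Y :: real^'p^'n. (1/2) * (\<Sum>i\<in>UNIV. \<Sum>j\<in>UNIV.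
      ((1/2) * ((\<Sum>k\<in>UNIV. Y $ k $ i * Y $ k $ j) - mat 1 $ i $ j))\<^sup>2))"
    unfolding fun_eq_iff orth_penalty_def orth_defect_def power2_norm_eq_inner inner_vec_def
    unfolding power2_eq_square by (simp add: matrix_matrix_mult_def transpose_def)
  show ?thesis
    unfolding eq by (intro differentiable_mult differentiable_sum differentiable_power differentiable_diff
        differentiable_const entry ballI finite)
qed

lemma ex1_landing_gradients:
  fixes f :: "real^'p^'n \<Rightarrow> real"
  assumes "rank X = CARD('p)"
  shows "f differentiable at X \<Longrightarrow> \<exists>!v. v \<in> stiefel_tangent X \<and>
      (\<forall>\<xi>\<in>stiefel_tangent X. landing_metric X v \<xi> = frechet_derivative f (at X) \<xi>)"
    and "\<exists>!v. v \<in> UNIV \<and>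
      (\<forall>\<xi>\<in>UNIV. landing_metric X v \<xi> = frechet_derivative orth_penalty (at X) \<xi>)"
  by (rule ex1_gradient_wrt[OF subspace_stiefel_tangent landing_metric_inner_product(1,2,4)[OF assms]]; assumption)
    (rule ex1_gradient_wrt[OF subspace_UNIV landing_metric_inner_product(1,2,4)[OF assms] differentiable_orth_penalty];
      assumption)

end

theory Submission
  imports Defs
begin

text \<open>
  The metric is \<open>\<langle>\<xi>, G \<zeta>\<rangle>\<close> with \<open>G = X X\<^sup>T + I - X S\<^sup>-\<^sup>1 X\<^sup>T\<close> symmetric and \<open>S = X\<^sup>T X\<close>, so a vector \<open>v\<close> is the
  gradient once \<open>\<langle>G v, \<xi>\<rangle>\<close> is the derivative in direction \<open>\<xi>\<close>. Since \<open>G\<close> acts on \<open>X A\<close> as \<open>X S A\<close> and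
  fixes the columns orthogonal to \<open>X\<close>, applying \<open>G\<close> to the claimed gradients just removes one factor
  \<open>S\<^sup>-\<^sup>1\<close>. For tangent \<open>\<xi>\<close> the matrix \<open>X\<^sup>T \<xi>\<close> is skew, hence pairs equally with \<open>skew M\<close> and \<open>M\<close>.
\<close>

lemma transpose_add: "transpose (A + B) = transpose A + transpose B"
  by (simp add: transpose_def vec_eq_iff)

lemma transpose_diff: "transpose (A - B) = transpose A - transpose B"
  for A B :: "'a::group_add^'m^'n"
  by (simp add: transpose_def vec_eq_iff)

lemma inner_transpose_transpose:
  fixes A B :: "real^'m^'n"
  shows "transpose A \<bullet> transpose B = A \<bullet> B"
  unfolding inner_vec_def transpose_def by (simp add: sum.swap[of _ "UNIV :: 'n set"])

lemma bounded_bilinear_matrix_mult: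
  "bounded_bilinear ((**) :: real^'m^'n \<Rightarrow> real^'p^'m \<Rightarrow> real^'p^'n)"
  unfolding bilinear_conv_bounded_bilinear[symmetric] bilinear_def
  by (intro conjI allI linearI)
    (simp_all add: matrix_add_ldistrib matrix_add_rdistrib scalar_matrix_assoc matrix_scalar_ac)

lemma bounded_linear_transpose: "bounded_linear (transpose :: real^'m^'n \<Rightarrow> real^'n^'m)"
  unfolding linear_conv_bounded_linear[symmetric]
  by (intro linearI transpose_add transpose_scalar)

lemma
  assumes "invertible A"
  shows matrix_inv_right: "A ** matrix_inv A = mat 1"
    and matrix_inv_left: "matrix_inv A ** A = mat 1"
  using someI_ex[OF assms[unfolded invertible_def]] unfolding matrix_inv_def by blast+

text \<open>Transposing \<open>matrix_inv A ** A = mat 1\<close> makes the transposed inverse a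
  right inverse of the symmetric \<open>A\<close>, and a right inverse agrees with the left
  inverse.\<close>

lemma matrix_inv_symmetric:
  fixes A :: "real^'n^'n"
  assumes "invertible A" "transpose A = A"
  shows "transpose (matrix_inv A) = matrix_inv A"
proof -
  have "A ** transpose (matrix_inv A) = mat 1"
    using assms by (metis matrix_inv_left matrix_transpose_mul transpose_mat)
  then show ?thesis
    using assms(1) by (metis matrix_inv_left matrix_mul_assoc matrix_mul_lid matrix_mul_rid)
qed

text \<open>Transposition is an isometry, so moving it from \<open>A\<close> onto \<open>W\<close>
  flips the sign: the symmetric part of \<open>A\<close> is orthogonal to every skew-symmetric
  \<open>W\<close>.\<close>

lemma inner_skew_left:
  fixes A W :: "real^'p^'p"
  assumes "transpose W = - W"
  shows "skew A \<bullet> W = A \<bullet> W"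
proof -
  have "transpose A \<bullet> W = - (A \<bullet> W)"
    using inner_transpose_transpose[of A W] assms by simp
  then show ?thesis
    by (simp add: skew_def inner_diff_left)
qed

lemma transpose_skew: "transpose (skew A) = - skew A"
  by (simp add: skew_def transpose_scalar transpose_diff scaleR_diff_right)

lemma stiefel_tangent_iff:
  "\<xi> \<in> stiefel_tangent X \<longleftrightarrow> transpose (transpose X ** \<xi>) = - (transpose X ** \<xi>)"
  by (simp add: stiefel_tangent_def matrix_transpose_mul eq_neg_iff_add_eq_0)

text \<open>With existence and uniqueness known, computing a gradient reduces to checking a
  candidate.\<close>

lemma gradient_wrt_eqI:
  assumes "\<exists>!v. v \<in> T \<and> (\<forall>\<xi>\<in>T. g v \<xi> = frechet_derivative f (at X) \<xi>)"
    and "v \<in> T" "\<And>\<xi>. \<xi> \<in> T \<Longrightarrow> g v \<xi> = frechet_derivative f (at X) \<xi>"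
  shows "gradient_wrt g T f X = v"
  unfolding gradient_wrt_def using assms by (intro the1_equality) auto

lemma inner_euclidean_gradient:
  fixes f :: "'a::euclidean_space \<Rightarrow> real"
  assumes "f differentiable at X"
  shows "euclidean_gradient f X \<bullet> \<xi> = frechet_derivative f (at X) \<xi>"
proof -
  have "\<exists>!v. v \<in> UNIV \<and> (\<forall>\<xi>\<in>UNIV. v \<bullet> \<xi> = frechet_derivative f (at X) \<xi>)"
    using assms
    by (intro ex1_gradient_wrt)
      (auto intro!: linearI simp: inner_left_distrib inner_right_distrib)
  from theI'[OF this] show ?thesis
    unfolding gradient_wrt_def by blast
qed

text \<open>By the product rule, the derivative of \<open>orth_defect\<close> is the symmetrization
  of \<open>transpose X ** \<xi>\<close>. Since \<open>orth_defect X\<close> is itself symmetric, it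
  pairs equally with both halves.\<close>

lemma frechet_derivative_orth_penalty:
  "frechet_derivative orth_penalty (at X) \<xi> = (X ** orth_defect X) \<bullet> \<xi>"
proof -
  let ?D = "\<lambda>\<xi>. (1/2) *\<^sub>R (transpose X ** \<xi> + transpose \<xi> ** X)"
  have mult: "((\<lambda>Y. transpose Y ** Y) has_derivative (\<lambda>\<xi>. transpose X ** \<xi> + transpose \<xi> ** X)) (at X)"
    by (intro bounded_bilinear.FDERIV[OF bounded_bilinear_matrix_mult]
        bounded_linear.has_derivative[OF bounded_linear_transpose] has_derivative_ident)
  have "((\<lambda>Y. (1/2) *\<^sub>R (transpose Y ** Y - mat 1)) has_derivative ?D) (at X)"
    by (rule derivative_eq_intros mult refl | simp)+
  then have defect: "(orth_defect has_derivative ?D) (at X)"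
    by (simp add: orth_defect_def[abs_def])
  have "((\<lambda>Y. (1/2) * (orth_defect Y \<bullet> orth_defect Y)) has_derivative
      (\<lambda>\<xi>. (1/2) * (orth_defect X \<bullet> ?D \<xi> + ?D \<xi> \<bullet> orth_defect X))) (at X)"
    by (intro has_derivative_mult_right has_derivative_inner defect)
  then have "(orth_penalty has_derivative
      (\<lambda>\<xi>. (1/2) * (orth_defect X \<bullet> ?D \<xi> + ?D \<xi> \<bullet> orth_defect X))) (at X)"
    by (simp add: orth_penalty_def[abs_def] power2_norm_eq_inner)
  \<comment> \<open>The two inner products coincide by symmetry, which cancels the factor
    1/2.\<close>
  from frechet_derivative_at[OF this]
  have "frechet_derivative orth_penalty (at X) \<xi> = orth_defect X \<bullet> ?D \<xi>"
    by (metis (no_types, lifting) inner_commute mult_2 mult.assoc field_sum_of_halves distrib_left mult_1 nonzero_eq_divide_eq)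
  moreover have "orth_defect X \<bullet> (transpose X ** \<xi>) = (X ** orth_defect X) \<bullet> \<xi>"
    by (simp add: inner_matrix_mult_left)
  moreover have "orth_defect X \<bullet> (transpose \<xi> ** X) = orth_defect X \<bullet> (transpose X ** \<xi>)"
  proof -
    have "transpose (orth_defect X) = orth_defect X"
      by (simp add: orth_defect_def transpose_scalar transpose_diff matrix_transpose_mul)
    then show ?thesis
      using inner_transpose_transpose[of "orth_defect X" "transpose X ** \<xi>"]
      by (simp add: matrix_transpose_mul)
  qed
  ultimately show ?thesis
    by (simp add: inner_add_right)
qed

text \<open>The gradient sits in the first slot of the metric, so the symmetric metric matrix is
  moved there, onto the candidate.\<close>

lemma landing_metric_eq_inner:
  fixes X :: "real^'p^'n"
  assumes "rank X = CARD('p)"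
  shows "landing_metric X v \<xi> =
    ((X ** transpose X + mat 1 - X ** matrix_inv (transpose X ** X) ** transpose X) ** v) \<bullet> \<xi>"
  by (metis assms inner_commute landing_metric_def landing_metric_inner_product(3))

theorem proposition7p12:
  fixes f :: "real^'p^'n \<Rightarrow> real" and X :: "real^'p^'n"
  assumes "CARD('p) \<le> CARD('n)"
    and "continuously_differentiable f"
    and "rank X = CARD('p)"
  shows "landing_tangent landing_metric f X =
           - (X ** matrix_inv (transpose X ** X)
                ** skew (matrix_inv (transpose X ** X) ** transpose X ** euclidean_gradient f X))
           - (mat 1 - X ** matrix_inv (transpose X ** X) ** transpose X) ** euclidean_gradient f X
       \<and> landing_normal landing_metric X =
           - (1/2) *\<^sub>R (X ** (mat 1 - matrix_inv (transpose X ** X)))"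
proof -
  define S where "S = transpose X ** X"
  define R where "R = matrix_inv S"
  define P where "P = X ** R ** transpose X"
  define E where "E = euclidean_gradient f X"
  define M where "M = R ** transpose X ** E"
  have inv: "invertible S"
    unfolding S_def using assms(3) by (rule invertible_gram)
  have SR: "S ** R = mat 1" and RS: "R ** S = mat 1"
    unfolding R_def using inv by (simp_all add: matrix_inv_left matrix_inv_right)
  have RT: "transpose R = R"
    unfolding R_def using inv by (rule matrix_inv_symmetric) (simp add: S_def matrix_transpose_mul)
  have metric: "landing_metric X v \<xi> = ((X ** transpose X + mat 1 - P) ** v) \<bullet> \<xi>" for v \<xi>
    using landing_metric_eq_inner[OF assms(3)] by (simp add: P_def R_def S_def)
  \<comment> \<open>\<open>P\<close> is the orthogonal projector onto the column space of
    \<open>X\<close>.\<close>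
  have XP: "transpose X ** P = transpose X"
    by (metis P_def S_def SR matrix_mul_assoc matrix_mul_lid)
  have PX: "P ** X = X"
    by (metis P_def S_def RS matrix_mul_assoc matrix_mul_rid)
  \<comment> \<open>On the column space \<open>mat 1 - P\<close> vanishes, so only
    \<open>X ** transpose X\<close> acts.\<close>
  have range: "(X ** transpose X + mat 1 - P) ** (X ** A) = X ** (S ** A)" for A :: "real^'p^'p"
    by (simp add: matrix_mul_assoc matrix_add_rdistrib matrix_diff_rdistrib PX)
      (simp add: S_def matrix_mul_assoc)
  have "transpose X ** (mat 1 - P) = 0"
    by (simp add: matrix_diff_ldistrib XP)
  then have XQ: "transpose X ** ((mat 1 - P) ** E) = 0"
    by (metis diff_self matrix_diff_rdistrib matrix_mul_assoc)
  have diff: "f differentiable at X"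
    using assms(2) by (auto simp: continuously_differentiable_def differentiable_def)

  have "gradient_wrt (landing_metric X) (stiefel_tangent X) f X =
      X ** R ** skew M + (mat 1 - P) ** E"
  proof (rule gradient_wrt_eqI[OF ex1_landing_gradients(1)[OF assms(3) diff]])
    let ?v = "X ** R ** skew M + (mat 1 - P) ** E"
    \<comment> \<open>By \<open>XQ\<close> the second summand drops out; as
      \<open>S ** R = mat 1\<close>, what remains is \<open>skew M\<close>, so \<open>?v\<close> is
      tangent.\<close>
    have "transpose X ** ?v = S ** R ** skew M"
      by (simp only: matrix_add_ldistrib XQ) (simp add: S_def matrix_mul_assoc)
    then show "?v \<in> stiefel_tangent X"
      by (simp add: stiefel_tangent_iff SR transpose_skew)
    fix \<xi> assume "\<xi> \<in> stiefel_tangent X"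
    then have skew: "transpose (transpose X ** \<xi>) = - (transpose X ** \<xi>)"
      by (simp add: stiefel_tangent_iff)
    have "(X ** transpose X + mat 1 - P) ** (X ** R ** skew M) = X ** skew M"
      using range[of "R ** skew M"] by (simp add: matrix_mul_assoc SR)
    \<comment> \<open>Both \<open>X ** transpose X\<close> and \<open>P\<close> begin by applying
      \<open>transpose X\<close>, which annihilates this residual; only the identity
      survives.\<close>
    moreover have "(X ** transpose X + mat 1 - P) ** ((mat 1 - P) ** E) = (mat 1 - P) ** E"
    proof -
      have "P ** ((mat 1 - P) ** E) = X ** R ** (transpose X ** ((mat 1 - P) ** E))"
        by (simp add: P_def matrix_mul_assoc)
      moreover have "X ** transpose X ** ((mat 1 - P) ** E) = X ** (transpose X ** ((mat 1 - P) ** E))"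
        by (simp add: matrix_mul_assoc)
      ultimately show ?thesis
        unfolding XQ by (simp add: matrix_add_rdistrib matrix_diff_rdistrib)
    qed
    ultimately have "landing_metric X ?v \<xi> = (X ** skew M) \<bullet> \<xi> + ((mat 1 - P) ** E) \<bullet> \<xi>"
      by (simp add: metric matrix_add_ldistrib inner_add_left)
    also have "(X ** skew M) \<bullet> \<xi> = skew M \<bullet> (transpose X ** \<xi>)"
      by (simp add: inner_matrix_mult_left)
    also have "\<dots> = M \<bullet> (transpose X ** \<xi>)"
      using skew by (rule inner_skew_left)
    \<comment> \<open>\<open>X ** M\<close> is the projection \<open>P ** E\<close>, which
      complements the residual to give all of \<open>E\<close>.\<close>
    also have "\<dots> = (P ** E) \<bullet> \<xi>"
      by (simp add: inner_matrix_mult_left M_def P_def matrix_mul_assoc)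
    also have "\<dots> + ((mat 1 - P) ** E) \<bullet> \<xi> = E \<bullet> \<xi>"
      by (simp add: matrix_diff_rdistrib inner_diff_left)
    finally show "landing_metric X ?v \<xi> = frechet_derivative f (at X) \<xi>"
      by (simp add: E_def inner_euclidean_gradient[OF diff])
  qed
  moreover have "gradient_wrt (landing_metric X) UNIV orth_penalty X = (1/2) *\<^sub>R (X ** (mat 1 - R))"
  proof (rule gradient_wrt_eqI[OF ex1_landing_gradients(2)[OF assms(3)] UNIV_I])
    fix \<xi>
    \<comment> \<open>\<open>S - mat 1\<close> is twice \<open>orth_defect X\<close>, whence the
      factor 1/2 in the normal direction.\<close>
    have "(X ** transpose X + mat 1 - P) ** (X ** (mat 1 - R)) = X ** (S - mat 1)"
      unfolding range by (simp add: matrix_diff_ldistrib SR)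
    then have "(X ** transpose X + mat 1 - P) ** ((1/2) *\<^sub>R (X ** (mat 1 - R))) = X ** orth_defect X"
      by (simp add: orth_defect_def S_def bounded_bilinear.scaleR_right[OF bounded_bilinear_matrix_mult])
    then show "landing_metric X ((1/2) *\<^sub>R (X ** (mat 1 - R))) \<xi>
        = frechet_derivative orth_penalty (at X) \<xi>"
      by (simp add: metric frechet_derivative_orth_penalty)
  qed
  ultimately show ?thesis
    by (simp add: landing_tangent_def landing_normal_def M_def E_def P_def R_def S_def)
qed

end
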